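(* For integers $t,r$ with $t+1\le r\le 3t-1$, we have \[ R(r,t) = \left\lfloor \frac{r-t}{2} \right\rfloor + 1. \]
   Context: All hypergraphs are finite. An $r$-uniform hypergraph $\mathcal H$ is $r$-partite if its vertex set can be partitioned as $V(\mathcal H)=P_1\sqcup\dots\sqcup P_r$ such that $|e\cap P_j|=1$ for every edge $e$ and every $j\in[r]$. It is $t$-intersecting if $|e\cap f|\ge t$ for all $e,f\in E(\mathcal H)$. An $(r,t)$-graph is an $r$-uniform, $r$-partite, $t$-intersecting hypergraph. A cover of $\mathcal H$ is a set $C\subseteq V(\mathcal H)$ with $C\cap e\neq\emptyset$ for every edge $e$; the cover number $\tau(\mathcal H)$ is the minimum size of a cover. $R(r,t)$ denotes the maximum of $\tau(\mathcal H)$ over all $(r,t)$-graphs $\mathcal H$. *)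

theory Defs
  imports Main "HOL-Library.Disjoint_Sets"
begin

text \<open>
  A finite hypergraph is given by its vertex set \<open>V\<close> and its edge set \<open>E\<close>. Isolated vertices and
  the hypergraph without edges are allowed.
\<close>

definition hypergraph :: "'a set \<Rightarrow> 'a set set \<Rightarrow> bool" where
  "hypergraph V E \<longleftrightarrow> finite V \<and> E \<subseteq> Pow V"

definition uniform :: "nat \<Rightarrow> 'a set set \<Rightarrow> bool" where
  "uniform r E \<longleftrightarrow> (\<forall>e\<in>E. card e = r)"

definition partite :: "nat \<Rightarrow> 'a set \<Rightarrow> 'a set set \<Rightarrow> bool" where
  "partite r V E \<longleftrightarrow>
     (\<exists>P :: nat \<Rightarrow> 'a set. disjoint_family_on P {1..r} \<and> V = (\<Union>j\<in>{1..r}. P j) \<and>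
        (\<forall>e\<in>E. \<forall>j\<in>{1..r}. card (e \<inter> P j) = 1))"

definition intersecting :: "nat \<Rightarrow> 'a set set \<Rightarrow> bool" where
  "intersecting t E \<longleftrightarrow> (\<forall>e\<in>E. \<forall>f\<in>E. t \<le> card (e \<inter> f))"

definition rt_graph :: "nat \<Rightarrow> nat \<Rightarrow> 'a set \<Rightarrow> 'a set set \<Rightarrow> bool" where
  "rt_graph r t V E \<longleftrightarrow> hypergraph V E \<and> uniform r E \<and> partite r V E \<and> intersecting t E"

definition cover :: "'a set \<Rightarrow> 'a set set \<Rightarrow> 'a set \<Rightarrow> bool" where
  "cover V E C \<longleftrightarrow> C \<subseteq> V \<and> (\<forall>e\<in>E. C \<inter> e \<noteq> {})"

definition cover_number :: "'a set \<Rightarrow> 'a set set \<Rightarrow> nat" where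
  "cover_number V E = Min {card C |C. cover V E C}"

text \<open>
  Finite hypergraphs may be taken to have natural numbers as vertices. For \<open>t \<ge> 1\<close> the maximum
  below exists and bounds the cover number over an arbitrary vertex type: see
  \<open>R_attained\<close> and \<open>cover_number_le_R\<close>. For \<open>t = 0\<close> it need not exist.
\<close>

definition R :: "nat \<Rightarrow> nat \<Rightarrow> nat" where
  "R r t = Max {cover_number V E |V E. rt_graph r t (V :: nat set) E}"

lemma finite_cover_cards: "finite V \<Longrightarrow> finite {card C |C. cover V E C}"
  by (rule finite_subset[of _ "card ` Pow V"]) (auto simp: cover_def)

lemma cover_number_le:
  assumes "finite V" "cover V E C"
  shows "cover_number V E \<le> card C"
  unfolding cover_number_def using assms finite_cover_cards[OF assms(1)] by (intro Min_le) auto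

lemma cover_number_attained:
  assumes "finite V" "cover V E C"
  obtains D where "cover V E D" "card D = cover_number V E"
proof -
  have "cover_number V E \<in> {card C |C. cover V E C}"
    unfolding cover_number_def using assms finite_cover_cards[OF assms(1)] by (intro Min_in) auto
  then show thesis using that by auto
qed

lemma rt_graph_cover:
  assumes "rt_graph r t V E" "t \<ge> 1"
  obtains C where "cover V E C" "card C \<le> r"
proof (cases "E = {}")
  case True
  then show thesis using that[of "{}"] by (auto simp: cover_def)
next
  case False
  then obtain e where e: "e \<in> E" by auto
  have "e \<inter> f \<noteq> {}" if "f \<in> E" for f
    using assms e that by (force simp: rt_graph_def intersecting_def)
  then show thesis
    using that[of e] assms e by (auto simp: cover_def rt_graph_def hypergraph_def uniform_def)
qed

lemma cover_number_le_uniformity: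
  assumes "rt_graph r t V E" "t \<ge> 1"
  shows "cover_number V E \<le> r"
proof -
  have "finite V" using assms by (simp add: rt_graph_def hypergraph_def)
  then show ?thesis using rt_graph_cover[OF assms] cover_number_le le_trans by metis
qed

lemma finite_cover_numbers:
  assumes "t \<ge> 1"
  shows "finite {cover_number V E |V E. rt_graph r t (V :: nat set) E}"
  by (rule finite_subset[of _ "{..r}"]) (auto dest: cover_number_le_uniformity[OF _ assms])

lemma rt_graph_empty: "rt_graph r t {} {}"
  by (auto simp: rt_graph_def hypergraph_def uniform_def partite_def intersecting_def
        disjoint_family_on_def intro!: exI[of _ "\<lambda>_. {}"])

lemma R_attained:
  assumes "t \<ge> 1"
  obtains V :: "nat set" and E where "rt_graph r t V E" "cover_number V E = R r t"
proof -
  have "R r t \<in> {cover_number V E |V E. rt_graph r t (V :: nat set) E}"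
    unfolding R_def using finite_cover_numbers[OF assms] by (intro Max_in) (use rt_graph_empty in blast)+
  then show thesis using that by auto
qed

lemma rt_graph_image:
  assumes H: "rt_graph r t V E" and inj: "inj_on g V"
  shows "rt_graph r t (g ` V) ((`) g ` E)"
proof -
  have sub: "\<And>e. e \<in> E \<Longrightarrow> e \<subseteq> V" and fin: "finite V"
    using H by (auto simp: rt_graph_def hypergraph_def)
  have card_eq: "card (g ` A) = card A" if "A \<subseteq> V" for A
    using that inj by (meson card_image inj_on_subset)
  have int: "g ` A \<inter> g ` B = g ` (A \<inter> B)" if "A \<subseteq> V" "B \<subseteq> V" for A B
    using inj_on_image_Int[OF inj that] by simp
  obtain P :: "nat \<Rightarrow> 'a set" where P: "disjoint_family_on P {1..r}" "V = (\<Union>j\<in>{1..r}. P j)"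
    "\<forall>e\<in>E. \<forall>j\<in>{1..r}. card (e \<inter> P j) = 1"
    using H by (auto simp: rt_graph_def partite_def)
  have PV: "P j \<subseteq> V" if "j \<in> {1..r}" for j using P(2) that by auto
  have "hypergraph (g ` V) ((`) g ` E)"
    using fin sub by (auto simp: hypergraph_def)
  moreover have "uniform r ((`) g ` E)"
    using H sub by (auto simp: rt_graph_def uniform_def card_eq)
  moreover have "intersecting t ((`) g ` E)"
    using H sub by (auto simp: rt_graph_def intersecting_def int card_eq le_infI1)
  moreover have "partite r (g ` V) ((`) g ` E)"
    unfolding partite_def
  proof (intro exI[of _ "\<lambda>j. g ` P j"] conjI ballI)
    show "disjoint_family_on (\<lambda>j. g ` P j) {1..r}"
      using P(1) PV unfolding disjoint_family_on_def by (metis int image_empty)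
    show "g ` V = (\<Union>j\<in>{1..r}. g ` P j)"
      using P(2) by auto
    fix e' j assume "e' \<in> (`) g ` E" and j: "j \<in> {1..r}"
    then obtain e where e: "e \<in> E" "e' = g ` e" by auto
    show "card (e' \<inter> g ` P j) = 1"
      using e j P(3) sub[OF e(1)] PV[OF j] by (simp add: int card_eq le_infI1)
  qed
  ultimately show ?thesis by (simp add: rt_graph_def)
qed

lemma cover_number_le_R:
  assumes H: "rt_graph r t V E" and t: "t \<ge> 1"
  shows "cover_number V E \<le> R r t"
proof -
  have fin: "finite V" and sub: "\<And>e. e \<in> E \<Longrightarrow> e \<subseteq> V"
    using H by (auto simp: rt_graph_def hypergraph_def)
  then obtain g :: "'a \<Rightarrow> nat" where inj: "inj_on g V"
    using finite_imp_inj_to_nat_seg by metis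
  let ?V = "g ` V" and ?E = "(`) g ` E"
  have H': "rt_graph r t ?V ?E" by (rule rt_graph_image[OF H inj])
  have fin': "finite ?V" using fin by simp
  obtain C where "cover ?V ?E C" using rt_graph_cover[OF H' t] by blast
  then obtain D where D: "cover ?V ?E D" "card D = cover_number ?V ?E"
    using cover_number_attained[OF fin'] by blast
  define B where "B = {v \<in> V. g v \<in> D}"
  have gB: "g ` B = D" using D(1) by (auto simp: B_def cover_def)
  have "cover V E B"
    unfolding cover_def
  proof (intro conjI ballI)
    show "B \<subseteq> V" by (auto simp: B_def)
    fix e assume e: "e \<in> E"
    then obtain x where "x \<in> e" "g x \<in> D" using D(1) by (auto simp: cover_def)
    then show "B \<inter> e \<noteq> {}" using sub[OF e] by (auto simp: B_def)
  qed
  then have "cover_number V E \<le> card B" by (rule cover_number_le[OF fin])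
  also have "card B = card D"
    using gB card_image[of g B] inj by (auto simp: B_def inj_on_def)
  also have "card D \<le> R r t"
    unfolding R_def D(2) using finite_cover_numbers[OF t] H' by (intro Max_ge) auto
  finally show ?thesis .
qed

end

theory Submission
  imports Defs
begin

text \<open>
  Upper bound: let \<open>e, f\<close> be edges with the smallest intersection, of size \<open>s \<ge> t\<close>. An edge \<open>g\<close>
  meets the symmetric difference of \<open>e\<close> and \<open>f\<close> in at most \<open>r - s\<close> vertices, since these lie in
  parts other than the \<open>s\<close> parts on which \<open>e\<close> and \<open>f\<close> agree. Adding \<open>card (g \<inter> e) \<ge> s\<close> and
  \<open>card (g \<inter> f) \<ge> s\<close> gives \<open>2 * card (g \<inter> e \<inter> f) + (r - s) \<ge> 2 * s\<close>, so \<open>g\<close> misses at most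
  \<open>(r - s) div 2\<close> vertices of \<open>e \<inter> f\<close>. Hence any \<open>(r - s) div 2 + 1\<close> vertices of \<open>e \<inter> f\<close> form a
  cover; there are that many because \<open>r \<le> 3 * t - 1\<close>.

  Lower bound: with \<open>k = (r - t) div 2\<close> and parts that are copies of \<open>{0..k}\<close>, take as edges all
  transversals with at most \<open>k\<close> nonzero entries. Two of them agree in at least \<open>r - 2 * k \<ge> t\<close>
  places, and \<open>k\<close> vertices can be avoided by changing at most \<open>k\<close> entries of the zero transversal.
\<close>

text \<open>Replaces the parts by an index map \<open>p\<close>, so that counting parts becomes
  counting images of vertex sets.\<close>

lemma partite_part_index:
  assumes "partite r V E" "hypergraph V E"
  obtains p :: "'a \<Rightarrow> nat" where "p ` V \<subseteq> {1..r}" "\<And>e. e \<in> E \<Longrightarrow> inj_on p e"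
proof -
  obtain P :: "nat \<Rightarrow> 'a set" where P: "V = (\<Union>j\<in>{1..r}. P j)"
    "\<forall>e\<in>E. \<forall>j\<in>{1..r}. card (e \<inter> P j) = 1"
    using assms(1) by (auto simp: partite_def)
  then have "\<forall>x\<in>V. \<exists>j. j \<in> {1..r} \<and> x \<in> P j" by blast
  then obtain p where p: "\<And>x. x \<in> V \<Longrightarrow> p x \<in> {1..r} \<and> x \<in> P (p x)" by metis
  have "inj_on p e" if e: "e \<in> E" for e
  proof (rule inj_onI)
    fix x y assume xy: "x \<in> e" "y \<in> e" "p x = p y"
    have eV: "e \<subseteq> V" using assms(2) e by (auto simp: hypergraph_def)
    then have "card (e \<inter> P (p x)) = 1" using P(2) e p xy by blast
    then obtain z where "e \<inter> P (p x) = {z}" by (auto simp: card_1_singleton_iff)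
    then show "x = y" using p[of x] p[of y] xy eV by (metis IntI singletonD subsetD)
  qed
  then show thesis using that[of p] p by blast
qed

lemma card_Int_symmetric_difference_le:
  assumes H: "rt_graph r t V E" and E: "e \<in> E" "f \<in> E" "g \<in> E"
  shows "card (g \<inter> (e - f)) + card (g \<inter> (f - e)) + card (e \<inter> f) \<le> r"
proof -
  have hyp: "hypergraph V E" "partite r V E" using H by (auto simp: rt_graph_def)
  then have sub: "e \<subseteq> V" "f \<subseteq> V" "g \<subseteq> V" and "finite V"
    using E by (auto simp: hypergraph_def)
  then have fin: "finite e" "finite f" "finite g" by (auto intro: finite_subset)
  obtain p :: "'a \<Rightarrow> nat" where p: "p ` V \<subseteq> {1..r}" "\<And>e. e \<in> E \<Longrightarrow> inj_on p e"
    using partite_part_index[OF hyp(2,1)] by metis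
  let ?X = "g \<inter> (e - f)" and ?Y = "g \<inter> (f - e)" and ?Z = "e \<inter> f"
  \<comment> \<open>A vertex of \<open>?X\<close> or \<open>?Y\<close> shares \<open>e\<close> or
    \<open>f\<close> with every vertex of \<open>?Z\<close>, so equal indices would make the two
    vertices equal.\<close>
  have disj: "p ` (?X \<union> ?Y) \<inter> p ` ?Z = {}"
    using p(2)[OF E(1)] p(2)[OF E(2)] by (auto simp: inj_on_def)
  have "card ?X + card ?Y = card (?X \<union> ?Y)"
    using fin by (intro card_Un_disjoint[symmetric]) auto
  also have "\<dots> = card (p ` (?X \<union> ?Y))"
    by (intro card_image[symmetric] inj_on_subset[OF p(2)[OF E(3)]]) auto
  finally have "card ?X + card ?Y = card (p ` (?X \<union> ?Y))" .
  moreover have "card ?Z = card (p ` ?Z)"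
    by (intro card_image[symmetric] inj_on_subset[OF p(2)[OF E(1)]]) auto
  moreover have "card (p ` (?X \<union> ?Y)) + card (p ` ?Z) = card (p ` (?X \<union> ?Y) \<union> p ` ?Z)"
    using fin disj by (intro card_Un_disjoint[symmetric]) auto
  moreover have "card (p ` (?X \<union> ?Y) \<union> p ` ?Z) \<le> card {1..r}"
    using p(1) sub by (intro card_mono) auto
  ultimately show ?thesis by simp
qed

lemma cover_number_le_half:
  assumes H: "rt_graph r t V E" and r: "r + 1 \<le> 3 * t"
  shows "cover_number V E \<le> (r - t) div 2 + 1"
proof (cases "E = {}")
  case True
  moreover have "finite V" using H by (simp add: rt_graph_def hypergraph_def)
  ultimately show ?thesis using cover_number_le[of V E "{}"] by (simp add: cover_def)
next
  case False
  have fin: "finite V" and sub: "\<And>e. e \<in> E \<Longrightarrow> e \<subseteq> V" and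
    int: "\<And>e f. e \<in> E \<Longrightarrow> f \<in> E \<Longrightarrow> t \<le> card (e \<inter> f)" and unif: "\<And>e. e \<in> E \<Longrightarrow> card e = r"
    using H by (auto simp: rt_graph_def hypergraph_def intersecting_def uniform_def)
  let ?m = "\<lambda>q. card (fst q \<inter> snd q)"
  \<comment> \<open>The pair may be diagonal, so a single edge needs no separate case; then
    \<open>s = r\<close>.\<close>
  obtain q where q: "q \<in> E \<times> E" "\<And>q'. q' \<in> E \<times> E \<Longrightarrow> ?m q \<le> ?m q'"
    using False ex_has_least_nat[of "\<lambda>q. q \<in> E \<times> E" _ ?m] by (metis SigmaI ex_in_conv)
  define e f s where "e = fst q" and "f = snd q" and "s = card (e \<inter> f)"
  have ef: "e \<in> E" "f \<in> E" using q(1) by (auto simp: e_def f_def)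
  have min: "s \<le> card (a \<inter> b)" if "a \<in> E" "b \<in> E" for a b
    using q(2)[of "(a, b)"] that by (simp add: s_def e_def f_def)
  have fine: "finite a" if "a \<in> E" for a using sub[OF that] fin by (rule finite_subset)
  have ts: "t \<le> s" using int ef by (simp add: s_def)
  have "s \<le> r" using unif[OF ef(1)] fine[OF ef(1)] card_mono[of e "e \<inter> f"] by (simp add: s_def)
  define d where "d = (r - s) div 2 + 1"
  \<comment> \<open>This amounts to \<open>r + 1 \<le> 3 * s\<close>, which follows from
    \<open>r\<close> and \<open>ts\<close>.\<close>
  have "d \<le> card (e \<inter> f)" using r ts by (simp add: d_def flip: s_def)
  then obtain C where C: "C \<subseteq> e \<inter> f" "card C = d" by (meson obtain_subset_with_card_n)
  have "C \<inter> g \<noteq> {}" if g: "g \<in> E" for g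
  proof
    assume empty: "C \<inter> g = {}"
    have split: "card (g \<inter> e) = card (g \<inter> (e \<inter> f)) + card (g \<inter> (e - f))"
      "card (g \<inter> f) = card (g \<inter> (e \<inter> f)) + card (g \<inter> (f - e))"
      using fine[OF g] card_Int_Diff[of "g \<inter> e" f] card_Int_Diff[of "g \<inter> f" e]
      by (simp_all add: Int_Diff Int_assoc Int_commute[of f e])
    have "card (g \<inter> (e \<inter> f)) + card C = card ((g \<inter> (e \<inter> f)) \<union> C)"
      using empty fine[OF g] finite_subset[OF C(1)] fine[OF ef(1)]
      by (intro card_Un_disjoint[symmetric]) auto
    also have "\<dots> \<le> s"
      unfolding s_def using C fine[OF ef(1)] by (intro card_mono) auto
    finally have "card (g \<inter> (e \<inter> f)) + d \<le> s" using C by simp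
    moreover have "card (g \<inter> (e - f)) + card (g \<inter> (f - e)) + s \<le> r"
      unfolding s_def by (rule card_Int_symmetric_difference_le[OF H ef g])
    \<comment> \<open>Adding up, \<open>2 * s \<le> 2 * (s - d) + (r - s)\<close>, so
      \<open>2 * d \<le> r - s\<close>, against the choice of \<open>d\<close>.\<close>
    ultimately show False
      using split min[OF g ef(1)] min[OF g ef(2)] by (simp add: d_def)
  qed
  then have "cover V E C" using C sub[OF ef(1)] by (auto simp: cover_def)
  then have "cover_number V E \<le> d" using cover_number_le[OF fin] C by blast
  also have "d \<le> (r - t) div 2 + 1" using ts by (simp add: d_def div_le_mono)
  finally show ?thesis .
qed

definition transversal :: "nat \<Rightarrow> (nat \<Rightarrow> nat) \<Rightarrow> (nat \<times> nat) set" where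
  "transversal r h = (\<lambda>j. (j, h j)) ` {1..r}"

definition sparse_transversals :: "nat \<Rightarrow> nat \<Rightarrow> (nat \<times> nat) set set" where
  "sparse_transversals r k =
     transversal r ` {h. (\<forall>j. h j \<le> k) \<and> card {j \<in> {1..r}. h j \<noteq> 0} \<le> k}"

lemma card_transversal: "card (transversal r h) = r"
  unfolding transversal_def by (subst card_image) (auto simp: inj_on_def)

lemma rt_graph_sparse_transversals:
  assumes "t + 2 * k \<le> r"
  shows "rt_graph r t ({1..r} \<times> {0..k}) (sparse_transversals r k)"
proof -
  have "partite r ({1..r} \<times> {0..k}) (sparse_transversals r k)"
    unfolding partite_def
  proof (intro exI[of _ "\<lambda>j. {j} \<times> {0..k}"] conjI ballI)
    fix e j assume e: "e \<in> sparse_transversals r k" and j: "j \<in> {1..r}"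
    then obtain h where "e = transversal r h" "\<forall>j. h j \<le> k"
      by (auto simp: sparse_transversals_def)
    then have "e \<inter> {j} \<times> {0..k} = {(j, h j)}" using j by (auto simp: transversal_def)
    then show "card (e \<inter> {j} \<times> {0..k}) = 1" by simp
  qed (auto simp: disjoint_family_on_def)
  moreover have "intersecting t (sparse_transversals r k)"
    unfolding intersecting_def
  proof (intro ballI)
    fix e f assume "e \<in> sparse_transversals r k" "f \<in> sparse_transversals r k"
    then obtain h h' where h: "e = transversal r h" "card {j \<in> {1..r}. h j \<noteq> 0} \<le> k"
      and h': "f = transversal r h'" "card {j \<in> {1..r}. h' j \<noteq> 0} \<le> k"
      by (auto simp: sparse_transversals_def)
    let ?N = "{j \<in> {1..r}. h j \<noteq> 0} \<union> {j \<in> {1..r}. h' j \<noteq> 0}"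
    have "card ?N \<le> 2 * k"
      using card_Un_le[of "{j \<in> {1..r}. h j \<noteq> 0}" "{j \<in> {1..r}. h' j \<noteq> 0}"] h(2) h'(2) by linarith
    \<comment> \<open>Outside \<open>?N\<close> both transversals have entry 0, so they share the
      vertices \<open>(j, 0)\<close>.\<close>
    then have "t \<le> card {1..r} - card ?N" using assms by simp
    also have "\<dots> \<le> card ({1..r} - ?N)" by (intro diff_card_le_card_Diff) auto
    also have "\<dots> = card ((\<lambda>j. (j, 0::nat)) ` ({1..r} - ?N))"
      by (rule card_image[symmetric]) (auto simp: inj_on_def)
    also have "\<dots> \<le> card (e \<inter> f)"
      by (intro card_mono) (auto simp: h(1) h'(1) transversal_def image_iff)
    finally show "t \<le> card (e \<inter> f)" .
  qed
  moreover have "hypergraph ({1..r} \<times> {0..k}) (sparse_transversals r k)"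
    by (auto simp: hypergraph_def sparse_transversals_def transversal_def)
  moreover have "uniform r (sparse_transversals r k)"
    by (auto simp: uniform_def sparse_transversals_def card_transversal)
  ultimately show ?thesis by (simp add: rt_graph_def)
qed

lemma cover_sparse_transversals_card:
  assumes C: "cover ({1..r} \<times> {0..k}) (sparse_transversals r k) C"
  shows "k < card C"
proof (rule ccontr)
  assume "\<not> k < card C"
  then have le: "card C \<le> k" by simp
  have fin: "finite C" using C by (auto simp: cover_def intro: finite_subset)
  \<comment> \<open>Each copy of \<open>{0..k}\<close> has \<open>k + 1\<close> vertices, more than
    \<open>C\<close> has.\<close>
  have "\<exists>c\<le>k. (j, c) \<notin> C" for j
  proof (rule ccontr)
    assume "\<not> ?thesis"
    then have "{j} \<times> {0..k} \<subseteq> C" by auto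
    from card_mono[OF fin this] show False using le by simp
  qed
  then obtain c where c: "\<And>j. c j \<le> k" "\<And>j. (j, c j) \<notin> C" by metis
  \<comment> \<open>Entries leave 0 only where \<open>C\<close> forces it, and each such index
    accounts for its own vertex \<open>(j, 0)\<close> of \<open>C\<close>.\<close>
  define h where "h j = (if (j, 0) \<in> C then c j else 0)" for j
  have "card {j \<in> {1..r}. h j \<noteq> 0} = card ((\<lambda>j. (j, 0::nat)) ` {j \<in> {1..r}. h j \<noteq> 0})"
    by (rule card_image[symmetric]) (auto simp: inj_on_def)
  also have "\<dots> \<le> card C"
    using fin by (intro card_mono) (auto simp: h_def split: if_splits)
  finally have "transversal r h \<in> sparse_transversals r k"
    using le c(1) by (auto simp: sparse_transversals_def h_def)
  moreover have "C \<inter> transversal r h = {}"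
    using c(2) by (auto simp: transversal_def h_def split: if_splits)
  ultimately show False using C by (auto simp: cover_def)
qed

lemma R_ge_half:
  assumes "1 \<le> t" "t \<le> r"
  shows "(r - t) div 2 + 1 \<le> R r t"
proof -
  define k where "k = (r - t) div 2"
  let ?V = "{1..r} \<times> {0..k}" and ?E = "sparse_transversals r k"
  have H: "rt_graph r t ?V ?E"
    using assms by (intro rt_graph_sparse_transversals) (simp add: k_def)
  obtain C where "cover ?V ?E C" using rt_graph_cover[OF H assms(1)] by blast
  then obtain D where "cover ?V ?E D" "card D = cover_number ?V ?E"
    using cover_number_attained[of ?V ?E C] by auto
  then have "k < cover_number ?V ?E" using cover_sparse_transversals_card by metis
  \<comment> \<open>The vertices are pairs while \<open>R\<close> ranges over hypergraphs on
    \<open>nat\<close>; this lemma bridges the types.\<close>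
  also have "\<dots> \<le> R r t" by (rule cover_number_le_R[OF H assms(1)])
  finally show ?thesis by (simp add: k_def)
qed

theorem theorem1p4:
  fixes r t :: nat
  assumes "t + 1 \<le> r" and "r \<le> 3 * t - 1"
  shows "R r t = (r - t) div 2 + 1"
proof (rule antisym)
  \<comment> \<open>For \<open>t = 0\<close> the truncated \<open>3 * t - 1\<close> is 0,
    contradicting \<open>t + 1 \<le> r\<close>.\<close>
  have t: "t \<ge> 1" using assms by linarith
  obtain V :: "nat set" and E where "rt_graph r t V E" "cover_number V E = R r t"
    using R_attained[OF t] by blast
  then show "R r t \<le> (r - t) div 2 + 1"
    using cover_number_le_half[of r t V E] assms by simp
  show "(r - t) div 2 + 1 \<le> R r t"
    using t assms by (intro R_ge_half) auto
qed

end
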